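(* The relation $\le$ ("easier than") on LJSDs defined in the context is a partial order over covariate shifts $\mu$, i.e. it is a reflexive, antisymmetric and transitive relation on the set of LJSDs $\mu$.
   Context: LJSD: a limiting joint spectral distribution, which specifies a covariate shift, is a probability measure $\mu$ on $\mathbb{R}_+^2$, the law of a pair $(\lambda,r)$ (training eigenvalue, overlap coefficient of the test covariance), either absolutely continuous or a finite sum of delta masses, with $\mathbb{E}_\mu[\lambda]$, $\mathbb{E}_\mu[r]$ finite. Relation: let $\mu_1,\mu_2$ be LJSDs with the same marginal distribution of $\lambda$, denoted $\mu_{\text{train}}$. If $\mathbb{E}_{\mu_1}[r|\lambda]/\mathbb{E}_{\mu_2}[r|\lambda]$ is nondecreasing as a function of $\lambda$ on the support of $\mu_{\text{train}}$ and $\mathbb{E}_{\mu_1}[r]\le\mathbb{E}_{\mu_2}[r]$, then $\mu_1$ is said to be easier than $\mu_2$ (equivalently $\mu_2$ harder than $\mu_1$), written $\mu_1\le\mu_2$.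
   Formalization: Antisymmetry holds only up to identifying LJSDs with the same μ_train and E[r|λ] a.e.: δ_(1,1) and (δ_(1,0)+δ_(1,2))/2 are each easier than the other but differ. The ratio is read for some versions of E[r|λ], with c/0=∞ and 0/0 points ignored. *)

theory Defs
  imports "HOL-Probability.Probability"
begin

text \<open>A pair \<open>(l, r)\<close> consists of a training eigenvalue and an overlap coefficient.\<close>

definition finite_sum_of_deltas :: "'a::topological_space measure \<Rightarrow> bool" where
  "finite_sum_of_deltas M \<longleftrightarrow>
     (\<exists>S w. finite S \<and> (\<forall>p\<in>S. 0 \<le> w p) \<and>
        (\<forall>A\<in>sets borel. emeasure M A = (\<Sum>p\<in>S. ennreal (w p) * emeasure (return borel p) A)))"

definition ljsd :: "(real \<times> real) measure \<Rightarrow> bool" where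
  "ljsd \<mu> \<longleftrightarrow>
     prob_space \<mu> \<and> sets \<mu> = sets borel \<and>
     (AE (l, r) in \<mu>. 0 \<le> l \<and> 0 \<le> r) \<and>
     (absolutely_continuous lborel \<mu> \<or> finite_sum_of_deltas \<mu>) \<and>
     integrable \<mu> fst \<and> integrable \<mu> snd"

definition train :: "(real \<times> real) measure \<Rightarrow> real measure" where
  "train \<mu> = distr \<mu> borel fst"

definition msupport :: "'a::topological_space measure \<Rightarrow> 'a set" where
  "msupport M = {x. \<forall>U. open U \<and> x \<in> U \<longrightarrow> emeasure M U > 0}"

text \<open>
  The conditional mean of \<open>r\<close> given \<open>l\<close>, as a function of \<open>l\<close>, is determined only up to null sets
  of the training marginal: \<open>cond_mean \<mu> g\<close> says that \<open>g\<close> is one of its versions.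
\<close>

definition cond_mean :: "(real \<times> real) measure \<Rightarrow> (real \<Rightarrow> real) \<Rightarrow> bool" where
  "cond_mean \<mu> g \<longleftrightarrow>
     g \<in> borel_measurable borel \<and> (\<forall>x. 0 \<le> g x) \<and>
     (AE p in \<mu>. real_cond_exp \<mu> (vimage_algebra (space \<mu>) fst borel) snd p = g (fst p))"

text \<open>
  The quotient of conditional means is taken in \<open>[0, \<infinity>]\<close>: a positive number over zero is \<open>\<infinity>\<close>.
  Points where it has the undefined form 0/0 impose no condition; in particular a law whose
  conditional mean vanishes somewhere remains comparable with itself.
\<close>

definition nondecreasing_ratio_on :: "real set \<Rightarrow> (real \<Rightarrow> real) \<Rightarrow> (real \<Rightarrow> real) \<Rightarrow> bool" where
  "nondecreasing_ratio_on S g h \<longleftrightarrow>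
     mono_on {x \<in> S. \<not> (g x = 0 \<and> h x = 0)} (\<lambda>x. ennreal (g x) / ennreal (h x))"

definition easier :: "(real \<times> real) measure \<Rightarrow> (real \<times> real) measure \<Rightarrow> bool" where
  "easier \<mu> \<nu> \<longleftrightarrow>
     train \<mu> = train \<nu> \<and>
     (\<exists>g h. cond_mean \<mu> g \<and> cond_mean \<nu> h \<and> nondecreasing_ratio_on (msupport (train \<mu>)) g h) \<and>
     (\<integral>p. snd p \<partial>\<mu>) \<le> (\<integral>p. snd p \<partial>\<nu>)"

text \<open>
  The relation \<open>easier\<close> depends on a law only through its training marginal and the conditional
  mean of \<open>r\<close>.  Distinct laws can share both: the unit mass at \<open>(1, 1)\<close> and the law giving mass 1/2
  to each of \<open>(1, 0)\<close> and \<open>(1, 2)\<close> are easier than each other.  So antisymmetry cannot hold for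
  equality of measures; two laws specify the same covariate shift if they agree in these two data.
\<close>

definition same_shift :: "(real \<times> real) measure \<Rightarrow> (real \<times> real) measure \<Rightarrow> bool" where
  "same_shift \<mu> \<nu> \<longleftrightarrow> train \<mu> = train \<nu> \<and> (\<exists>g. cond_mean \<mu> g \<and> cond_mean \<nu> g)"

end

(* For nonnegative g and h, monotonicity of the quotient g/h in [0, \<infinity>] amounts to the inequality
   g x * h y <= g y * h x for x <= y, which also holds trivially at points of the form 0/0.  Hence
   versions of conditional means may be replaced by 0 on a null set without harming monotonicity.
   Transitivity of the inequality fails only if the middle conditional mean vanishes on the whole
   support; then the comparison of means forces the smaller one to vanish too.  For antisymmetry,
   integrating g x * h y = g y * h x over x gives g = h a.e., as both have the same integral. *)
theory Submission
  imports Defs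
begin

section \<open>Cross-multiplied inequalities for ratios\<close>

lemma nondecreasing_ratio_on_iff:
  assumes "\<And>x. 0 \<le> g x" "\<And>x. 0 \<le> h x"
  shows "nondecreasing_ratio_on S g h \<longleftrightarrow>
    (\<forall>x\<in>S. \<forall>y\<in>S. x \<le> y \<longrightarrow> g x * h y \<le> g y * h x)"
proof -
  \<comment> \<open>With 0/0 excluded, a zero denominator comes with a positive numerator, so the
    quotient is \<top>; otherwise it is an ordinary real quotient.\<close>
  have quotient_le_iff: "ennreal a / ennreal b \<le> ennreal c / ennreal d \<longleftrightarrow> a * d \<le> c * b"
    if "0 \<le> a" "0 \<le> b" "0 \<le> c" "0 \<le> d" "\<not> (a = 0 \<and> b = 0)" "\<not> (c = 0 \<and> d = 0)"
    for a b c d :: real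
  proof (cases "b = 0")
    case True
    then have "a > 0" using that by auto
    then have top: "ennreal a / ennreal b = \<top>"
      using True by (simp add: divide_ennreal_def ennreal_mult_top)
    show ?thesis
    proof (cases "d = 0")
      case False
      then have "ennreal c / ennreal d = ennreal (c / d)"
        using that by (simp add: divide_ennreal)
      then show ?thesis using top True False \<open>a > 0\<close> that
        by (auto simp: top_unique mult_le_0_iff)
    qed (use that True top in \<open>auto simp: divide_ennreal_def ennreal_mult_top\<close>)
  next
    case False
    then have ab: "ennreal a / ennreal b = ennreal (a / b)"
      using that by (simp add: divide_ennreal)
    show ?thesis
    proof (cases "d = 0")
      case True
      then have "ennreal c / ennreal d = \<top>"
        using that by (auto simp: divide_ennreal_def ennreal_mult_top)
      then show ?thesis using True that by simp
    next
      case d: False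
      then have cd: "ennreal c / ennreal d = ennreal (c / d)"
        using that by (simp add: divide_ennreal)
      have "b > 0" "d > 0" using that False d by auto
      then show ?thesis using that unfolding ab cd
        by (simp add: ennreal_le_iff field_simps)
    qed
  qed
  show ?thesis
    unfolding nondecreasing_ratio_on_def mono_on_def
  proof (intro iffI ballI impI allI; (elim conjE)?)
    fix x y
    assume *: "\<forall>r s. r \<in> {x \<in> S. \<not> (g x = 0 \<and> h x = 0)} \<and> s \<in> {x \<in> S. \<not> (g x = 0 \<and> h x = 0)} \<and> r \<le> s \<longrightarrow>
      ennreal (g r) / ennreal (h r) \<le> ennreal (g s) / ennreal (h s)"
      and "x \<in> S" "y \<in> S" "x \<le> y"
    \<comment> \<open>If either point has the form 0/0, both products vanish.\<close>
    then show "g x * h y \<le> g y * h x"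
      using quotient_le_iff[of "g x" "h x" "g y" "h y"] assms
      by (cases "(g x = 0 \<and> h x = 0) \<or> (g y = 0 \<and> h y = 0)") auto
  next
    fix x y
    assume "\<forall>x\<in>S. \<forall>y\<in>S. x \<le> y \<longrightarrow> g x * h y \<le> g y * h x" "x \<le> y"
      and "x \<in> {x \<in> S. \<not> (g x = 0 \<and> h x = 0)}" "y \<in> {x \<in> S. \<not> (g x = 0 \<and> h x = 0)}"
    then show "ennreal (g x) / ennreal (h x) \<le> ennreal (g y) / ennreal (h y)"
      using quotient_le_iff[of "g x" "h x" "g y" "h y"] assms by auto
  qed
qed

text \<open>Where \<open>h\<close> is positive, the two inequalities are multiplied and
  \<open>h x * h y\<close> is cancelled. Zeros of \<open>h\<close> are controlled by comparison with
  \<open>z\<close>: to its left they force \<open>g\<close> to vanish, to its right they force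
  \<open>k\<close> to vanish.\<close>

lemma cross_le_trans:
  fixes g h k :: "real \<Rightarrow> real"
  assumes nonneg: "\<And>x. 0 \<le> g x" "\<And>x. 0 \<le> h x" "\<And>x. 0 \<le> k x"
    and gh: "\<And>x y. x \<in> S \<Longrightarrow> y \<in> S \<Longrightarrow> x \<le> y \<Longrightarrow> g x * h y \<le> g y * h x"
    and hk: "\<And>x y. x \<in> S \<Longrightarrow> y \<in> S \<Longrightarrow> x \<le> y \<Longrightarrow> h x * k y \<le> h y * k x"
    and z: "z \<in> S" "h z \<noteq> 0"
    and xy: "x \<in> S" "y \<in> S" "x \<le> y"
  shows "g x * k y \<le> g y * k x"
proof -
  have zpos: "h z > 0" using z nonneg(2)[of z] by linarith
  have left: "g u = 0" if "u \<in> S" "h u = 0" "u \<le> z" for u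
    using gh[of u z] that z zpos nonneg(1)[of u] by (simp add: mult_le_0_iff)
  have right: "k u = 0" if "u \<in> S" "h u = 0" "z \<le> u" for u
    using hk[of z u] that z zpos nonneg(3)[of u] by (simp add: mult_le_0_iff)
  have rhs: "0 \<le> g y * k x" using nonneg by simp
  consider "h x > 0" "h y > 0" | "h y = 0" | "h x = 0"
    using nonneg(2)[of x] nonneg(2)[of y] by linarith
  then show ?thesis
  proof cases
    case 1
    have "(g x * h y) * (h x * k y) \<le> (g y * h x) * (h y * k x)"
      by (intro mult_mono gh hk xy) (simp_all add: nonneg)
    then have "(g x * k y) * (h x * h y) \<le> (g y * k x) * (h x * h y)"
      by (simp add: mult_ac)
    then show ?thesis using 1 by simp
  next
    case 2
    have "k y = 0 \<or> g x = 0"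
    proof (cases "z \<le> y")
      case True
      then show ?thesis using right xy 2 by blast
    next
      case False
      \<comment> \<open>Left of \<open>z\<close> the zero of \<open>h\<close> at \<open>y\<close>
        only gives \<open>g y = 0\<close>, whereas \<open>g x\<close> is wanted. Unless
        \<open>k y = 0\<close>, the inequality between \<open>h\<close> and \<open>k\<close> carries
        the zero back to \<open>x\<close>. The remaining case is the mirror image.\<close>
      have "h x * k y \<le> 0" using hk[OF xy] 2 by simp
      then have "h x = 0 \<or> k y = 0"
        using nonneg(2)[of x] nonneg(3)[of y] by (auto simp: mult_le_0_iff)
      then show ?thesis using left[of x] xy False by auto
    qed
    then show ?thesis using rhs by auto
  next
    case 3
    have "k y = 0 \<or> g x = 0"
    proof (cases "x \<le> z")
      case True
      then show ?thesis using left xy 3 by blast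
    next
      case False
      have "g x * h y \<le> 0" using gh[OF xy] 3 by simp
      then have "g x = 0 \<or> h y = 0"
        using nonneg(1)[of x] nonneg(2)[of y] by (auto simp: mult_le_0_iff)
      then show ?thesis using right[of y] xy False by auto
    qed
    then show ?thesis using rhs by auto
  qed
qed

section \<open>Support and training marginal\<close>

text \<open>The complement of the support is the union of all open null sets, and by Lindelof
  countably many of them already cover it.\<close>

lemma AE_msupport:
  fixes M :: "'a::second_countable_topology measure"
  assumes "sets M = sets borel"
  shows "AE x in M. x \<in> msupport M"
proof -
  let ?F = "{U. open U \<and> emeasure M U = 0}"
  obtain F where F: "F \<subseteq> ?F" "countable F" "\<Union>F = \<Union>?F"
    using Lindelof[of ?F] by blast
  have "(\<Union>U\<in>F. U) \<in> null_sets M"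
    by (rule null_sets_UN') (use F assms in \<open>auto simp: null_sets_def\<close>)
  moreover have "{x \<in> space M. x \<notin> msupport M} \<subseteq> \<Union>?F"
    by (auto simp: msupport_def)
  ultimately show ?thesis
    using F(3) by (intro AE_I'[of "\<Union>?F"]) auto
qed

lemma sets_train [simp]: "sets (train \<mu>) = sets borel"
  and space_train [simp]: "space (train \<mu>) = UNIV"
  by (simp_all add: train_def)

lemma fst_measurable_ljsd: "ljsd \<mu> \<Longrightarrow> fst \<in> \<mu> \<rightarrow>\<^sub>M borel"
  by (auto simp: ljsd_def dest: borel_measurable_integrable)

lemma AE_train_iff:
  assumes "ljsd \<mu>" "{x. P x} \<in> sets borel"
  shows "(AE x in train \<mu>. P x) \<longleftrightarrow> (AE p in \<mu>. P (fst p))"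
  unfolding train_def by (rule AE_distr_iff) (use assms fst_measurable_ljsd in auto)

lemma finite_measure_subalgebra_ljsd:
  assumes "ljsd \<mu>"
  shows "finite_measure_subalgebra \<mu> (vimage_algebra (space \<mu>) fst borel)"
proof -
  interpret prob_space \<mu> using assms by (simp add: ljsd_def)
  show ?thesis
  proof
    show "subalgebra \<mu> (vimage_algebra (space \<mu>) fst borel)"
      using fst_measurable_ljsd[OF assms]
      by (simp add: subalgebra_def measurable_iff_sets)
  qed
qed

section \<open>Versions of the conditional mean\<close>

lemma cond_mean_AE_unique:
  assumes "ljsd \<mu>" "cond_mean \<mu> g" "cond_mean \<mu> h"
  shows "AE x in train \<mu>. g x = h x"
proof -
  have [measurable]: "g \<in> borel_measurable borel" "h \<in> borel_measurable borel"
    using assms by (simp_all add: cond_mean_def)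
  have "AE p in \<mu>. g (fst p) = h (fst p)"
    using assms unfolding cond_mean_def by auto
  then show ?thesis using AE_train_iff[OF assms(1)] by simp
qed

lemma cond_mean_cong_AE:
  assumes "ljsd \<mu>" "cond_mean \<mu> g" "AE x in train \<mu>. g x = h x"
    and "h \<in> borel_measurable borel" "\<And>x. 0 \<le> h x"
  shows "cond_mean \<mu> h"
proof -
  have [measurable]: "g \<in> borel_measurable borel" "h \<in> borel_measurable borel"
    using assms by (simp_all add: cond_mean_def)
  have "AE p in \<mu>. g (fst p) = h (fst p)"
    using AE_train_iff[OF assms(1), of "\<lambda>x. g x = h x"] assms(3) by simp
  then show ?thesis using assms unfolding cond_mean_def by auto
qed

text \<open>Tower property of conditional expectation, followed by a change of variables along
  \<open>fst\<close>.\<close>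

lemma integral_cond_mean:
  assumes "ljsd \<mu>" "cond_mean \<mu> g"
  shows "integrable (train \<mu>) g" "(\<integral>x. g x \<partial>train \<mu>) = (\<integral>p. snd p \<partial>\<mu>)"
proof -
  interpret finite_measure_subalgebra \<mu> "vimage_algebra (space \<mu>) fst borel"
    by (rule finite_measure_subalgebra_ljsd[OF assms(1)])
  let ?E = "real_cond_exp \<mu> (vimage_algebra (space \<mu>) fst borel) snd"
  have int: "integrable \<mu> snd" using assms by (simp add: ljsd_def)
  have [measurable]: "g \<in> borel_measurable borel" "fst \<in> \<mu> \<rightarrow>\<^sub>M borel"
    using assms fst_measurable_ljsd by (simp_all add: cond_mean_def)
  have m: "(\<lambda>p. g (fst p)) \<in> borel_measurable \<mu>" by measurable
  have ae: "AE p in \<mu>. ?E p = g (fst p)" using assms by (simp add: cond_mean_def)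
  have "integrable \<mu> (\<lambda>p. g (fst p))"
    using integrable_cong_AE_imp[OF real_cond_exp_int(1)[OF int] m] ae by auto
  then show "integrable (train \<mu>) g" by (simp add: train_def integrable_distr_eq)
  have "(\<integral>p. g (fst p) \<partial>\<mu>) = (\<integral>p. ?E p \<partial>\<mu>)"
    by (rule integral_cong_AE) (use ae m in auto)
  then show "(\<integral>x. g x \<partial>train \<mu>) = (\<integral>p. snd p \<partial>\<mu>)"
    using real_cond_exp_int(2)[OF int] by (simp add: train_def integral_distr)
qed

text \<open>A nonnegative function whose integral is not positive vanishes almost everywhere. This
  settles the degenerate cases of antisymmetry and transitivity.\<close>

lemma cond_mean_AE_zero:
  assumes "ljsd \<mu>" "cond_mean \<mu> g" "(\<integral>p. snd p \<partial>\<mu>) \<le> 0"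
  shows "AE x in train \<mu>. g x = 0"
proof -
  have "0 \<le> g x" for x using assms by (simp add: cond_mean_def)
  moreover from this have "(\<integral>x. g x \<partial>train \<mu>) = 0"
    using integral_cond_mean(2)[OF assms(1,2)] assms(3) integral_nonneg_AE[of g "train \<mu>"] by simp
  ultimately show ?thesis
    using integral_nonneg_eq_0_iff_AE[OF integral_cond_mean(1)[OF assms(1,2)]] by simp
qed

text \<open>Reflexivity rests on this, since \<open>easier\<close> asks for actual versions. The
  argument is a Doob-Dynkin factorisation through \<open>fst\<close>.\<close>

lemma cond_mean_exists:
  assumes "ljsd \<mu>"
  shows "\<exists>g. cond_mean \<mu> g"
proof -
  interpret finite_measure_subalgebra \<mu> "vimage_algebra (space \<mu>) fst borel"
    by (rule finite_measure_subalgebra_ljsd[OF assms])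
  let ?A = "vimage_algebra (space \<mu>) fst (borel :: real measure)"
  let ?E = "real_cond_exp \<mu> ?A snd"
  have sets: "sets \<mu> = sets borel" using assms by (simp add: ljsd_def)
  then have space: "space \<mu> = UNIV" using sets_eq_imp_space_eq by fastforce
  \<comment> \<open>Sets of the generated algebra are unions of fibres of \<open>fst\<close>, so a function measurable for it
    is constant on them and can be read off along the section \<open>l \<mapsto> (l, 0)\<close>.\<close>
  have fibre: "?E (l, r) = ?E (l, 0)" for l r
  proof -
    have "?E -` {?E (l, 0)} \<inter> space ?A \<in> sets ?A"
      by (rule measurable_sets[OF borel_measurable_cond_exp]) simp
    then obtain B where "?E -` {?E (l, 0)} = fst -` B"
      by (auto simp: space sets_vimage_algebra2)
    then have "(l, s) \<in> ?E -` {?E (l, 0)} \<longleftrightarrow> l \<in> B" for s by auto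
    from this[of r] this[of 0] show ?thesis by auto
  qed
  have "?E \<in> borel_measurable borel"
    using borel_measurable_cond_exp2[of \<mu> ?A snd] measurable_cong_sets[OF sets refl] by blast
  then have m: "(\<lambda>l. ?E (l, 0)) \<in> borel_measurable borel"
    by (rule measurable_compose[rotated]) (simp add: borel_prod[symmetric])
  have "AE p in \<mu>. 0 \<le> ?E p"
    by (rule real_cond_exp_pos) (use assms in \<open>auto simp: ljsd_def\<close>)
  \<comment> \<open>The maximum with 0 is taken because \<open>cond_mean\<close> demands
    nonnegativity at every point, while the conditional expectation is nonnegative only almost
    everywhere.\<close>
  then have "AE p in \<mu>. ?E p = max 0 (?E (fst p, 0))"
    by eventually_elim (metis fibre max_def prod.collapse)
  then have "cond_mean \<mu> (\<lambda>l. max 0 (?E (l, 0)))"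
    using m unfolding cond_mean_def by auto
  then show ?thesis by blast
qed

section \<open>The order properties\<close>

lemma same_shift_sym: "same_shift \<mu> \<nu> \<Longrightarrow> same_shift \<nu> \<mu>"
  by (auto simp: same_shift_def)

text \<open>With a common version \<open>g\<close> the cross-multiplied condition is an equality,
  and both means are the integral of \<open>g\<close> over the shared marginal. Reflexivity is the
  case of equal laws.\<close>

lemma same_shift_imp_easier:
  assumes "ljsd \<mu>" "ljsd \<nu>" "same_shift \<mu> \<nu>"
  shows "easier \<mu> \<nu>"
proof -
  obtain g where g: "cond_mean \<mu> g" "cond_mean \<nu> g" and train: "train \<mu> = train \<nu>"
    using assms by (auto simp: same_shift_def)
  have "nondecreasing_ratio_on (msupport (train \<mu>)) g g"
    using g by (subst nondecreasing_ratio_on_iff) (auto simp: cond_mean_def mult.commute)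
  moreover have "(\<integral>p. snd p \<partial>\<mu>) = (\<integral>p. snd p \<partial>\<nu>)"
    using integral_cond_mean(2)[OF assms(1) g(1)] integral_cond_mean(2)[OF assms(2) g(2)] train
    by simp
  ultimately show ?thesis using g train unfolding easier_def by auto
qed

lemma easier_antisym:
  assumes \<mu>: "ljsd \<mu>" and \<nu>: "ljsd \<nu>" and "easier \<mu> \<nu>" "easier \<nu> \<mu>"
  shows "same_shift \<mu> \<nu>"
proof -
  let ?T = "train \<mu>"
  let ?S = "msupport ?T"
  let ?m = "\<integral>p. snd p \<partial>\<mu>"
  have train: "train \<nu> = ?T" and mean: "(\<integral>p. snd p \<partial>\<nu>) = ?m"
    using assms by (auto simp: easier_def)
  obtain g h where gh: "cond_mean \<mu> g" "cond_mean \<nu> h" "nondecreasing_ratio_on ?S g h"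
    using assms by (auto simp: easier_def)
  obtain h' g' where hg: "cond_mean \<nu> h'" "cond_mean \<mu> g'" "nondecreasing_ratio_on ?S h' g'"
    using assms train by (auto simp: easier_def)
  have nonneg: "\<And>x. 0 \<le> g x" "\<And>x. 0 \<le> h x" "\<And>x. 0 \<le> g' x" "\<And>x. 0 \<le> h' x"
    using gh hg by (simp_all add: cond_mean_def)
  \<comment> \<open>The two comparisons may use different versions; on this conull set they speak of
    the same pair of functions.\<close>
  let ?Z = "{x \<in> ?S. g x = g' x \<and> h x = h' x}"
  have Z: "AE x in ?T. x \<in> ?Z"
    using cond_mean_AE_unique[OF \<mu> gh(1) hg(2)] cond_mean_AE_unique[OF \<nu> gh(2) hg(1)]
      AE_msupport[of ?T, simplified] unfolding train by eventually_elim simp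
  have gh_le: "g u * h v \<le> g v * h u" and hg_le: "h' u * g' v \<le> h' v * g' u"
    if "u \<in> ?S" "v \<in> ?S" "u \<le> v" for u v
    using gh(3) hg(3) that by (simp_all add: nondecreasing_ratio_on_iff nonneg)
  have cross: "g x * h y = g y * h x" if "x \<in> ?Z" "y \<in> ?Z" for x y
  proof -
    \<comment> \<open>On \<open>?Z\<close> the two monotonicity conditions are opposite inequalities
      between the same products.\<close>
    have le: "g u * h v = g v * h u" if "u \<in> ?Z" "v \<in> ?Z" "u \<le> v" for u v
      using gh_le[of u v] hg_le[of u v] that by (simp add: mult.commute)
    show ?thesis using le[of x y] le[of y x] that by (cases "x \<le> y") auto
  qed
  have ig: "integrable ?T g" "(\<integral>x. g x \<partial>?T) = ?m"
    and ih: "integrable ?T h" "(\<integral>x. h x \<partial>?T) = ?m"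
    using integral_cond_mean[OF \<mu> gh(1)] integral_cond_mean[OF \<nu> gh(2)] train mean by simp_all
  have "AE x in ?T. g x = h x"
  \<comment> \<open>Integrating over \<open>x\<close> with \<open>y\<close> fixed gives
    \<open>?m * h y = g y * ?m\<close>, where \<open>?m\<close> can be cancelled only if it is
    nonzero. If it is zero, both versions vanish almost everywhere.\<close>
  proof (cases "?m = 0")
    case True
    then show ?thesis
      using cond_mean_AE_zero[OF \<mu> gh(1)] cond_mean_AE_zero[OF \<nu> gh(2)] mean
      unfolding train by auto
  next
    case False
    have "g y = h y" if "y \<in> ?Z" for y
    proof -
      have "(\<integral>x. g x * h y \<partial>?T) = (\<integral>x. g y * h x \<partial>?T)"
      proof (rule integral_cong_AE)
        show "AE x in ?T. g x * h y = g y * h x"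
          using Z by eventually_elim (use cross that in blast)
      qed (use ig ih in auto)
      then show ?thesis using ig ih False by (simp add: mult.commute)
    qed
    then show ?thesis using Z by auto
  qed
  then have "AE x in train \<nu>. h x = g x"
    unfolding train by eventually_elim simp
  then have "cond_mean \<nu> g"
    using gh by (intro cond_mean_cong_AE[OF \<nu> gh(2)]) (auto simp: cond_mean_def)
  then show ?thesis using gh train by (auto simp: same_shift_def)
qed

lemma easier_trans:
  assumes \<mu>: "ljsd \<mu>" and \<nu>: "ljsd \<nu>" and \<rho>: "ljsd \<rho>" and "easier \<mu> \<nu>" "easier \<nu> \<rho>"
  shows "easier \<mu> \<rho>"
proof -
  let ?T = "train \<mu>"
  let ?S = "msupport ?T"
  have train: "train \<nu> = ?T" "train \<rho> = ?T"
    and mean: "(\<integral>p. snd p \<partial>\<mu>) \<le> (\<integral>p. snd p \<partial>\<nu>)" "(\<integral>p. snd p \<partial>\<mu>) \<le> (\<integral>p. snd p \<partial>\<rho>)"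
    using assms by (auto simp: easier_def)
  obtain g h where gh: "cond_mean \<mu> g" "cond_mean \<nu> h" "nondecreasing_ratio_on ?S g h"
    using assms by (auto simp: easier_def)
  obtain h' k where hk: "cond_mean \<nu> h'" "cond_mean \<rho> k" "nondecreasing_ratio_on ?S h' k"
    using assms train by (auto simp: easier_def)
  have nonneg: "\<And>x. 0 \<le> g x" "\<And>x. 0 \<le> h x" "\<And>x. 0 \<le> h' x" "\<And>x. 0 \<le> k x"
    using gh hk by (simp_all add: cond_mean_def)
  have [measurable]: "g \<in> borel_measurable borel" "h \<in> borel_measurable borel"
    "h' \<in> borel_measurable borel" "k \<in> borel_measurable borel"
    using gh hk by (simp_all add: cond_mean_def)
  have gh_le: "g u * h v \<le> g v * h u" and hk_le: "h' u * k v \<le> h' v * k u"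
    if "u \<in> ?S" "v \<in> ?S" "u \<le> v" for u v
    using gh(3) hk(3) that by (simp_all add: nondecreasing_ratio_on_iff nonneg)
  have hh': "AE x in ?T. h x = h' x"
    using cond_mean_AE_unique[OF \<nu> gh(2) hk(1)] unfolding train .
  have "\<exists>a c. cond_mean \<mu> a \<and> cond_mean \<rho> c \<and> nondecreasing_ratio_on ?S a c"
  \<comment> \<open>Such a \<open>z\<close> is the anchor that \<open>cross_le_trans\<close>
    requires, at a point where both versions of the middle conditional mean agree.\<close>
  proof (cases "\<exists>z\<in>?S. h z = h' z \<and> h z \<noteq> 0")
    case True
    then obtain z where z: "z \<in> ?S" "h z = h' z" "h z \<noteq> 0" by blast
    let ?Z = "{x \<in> ?S. h x = h' x}"
    define a where "a = (\<lambda>x. if h x = h' x then g x else 0)"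
    define c where "c = (\<lambda>x. if h x = h' x then k x else 0)"
    have eq_c: "AE x in train \<rho>. k x = c x"
      using hh' unfolding train c_def by eventually_elim simp
    have "cond_mean \<mu> a"
      by (rule cond_mean_cong_AE[OF \<mu> gh(1)]) (use hh' nonneg in \<open>auto simp: a_def\<close>)
    moreover have "cond_mean \<rho> c"
      by (rule cond_mean_cong_AE[OF \<rho> hk(2) eq_c]) (use nonneg in \<open>auto simp: c_def\<close>)
    moreover have "g x * k y \<le> g y * k x" if "x \<in> ?Z" "y \<in> ?Z" "x \<le> y" for x y
    proof (rule cross_le_trans[where S = ?Z and h = h and z = z])
      show "g u * h v \<le> g v * h u" if "u \<in> ?Z" "v \<in> ?Z" "u \<le> v" for u v
        using gh_le that by blast
      show "h u * k v \<le> h v * k u" if "u \<in> ?Z" "v \<in> ?Z" "u \<le> v" for u v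
        using hk_le[of u v] that by simp
    qed (use z that nonneg in auto)
    \<comment> \<open>If one of the two points lies outside \<open>?Z\<close>, then \<open>a\<close>
      and \<open>c\<close> both vanish there and the inequality reads 0 \<le> 0.\<close>
    then have "nondecreasing_ratio_on ?S a c"
      by (subst nondecreasing_ratio_on_iff) (auto simp: a_def c_def nonneg)
    ultimately show ?thesis by blast
  next
    case False
    \<comment> \<open>Almost every point lies in the support and satisfies
      \<open>h x = h' x\<close>, so the absence of an anchor makes \<open>h\<close> vanish there.
      The middle mean is then 0 and bounds the mean of \<open>\<mu>\<close>.\<close>
    have "AE x in ?T. h x = 0"
      using AE_msupport[of ?T, simplified] hh' by eventually_elim (use False in blast)
    then have "(\<integral>x. h x \<partial>?T) = 0" by (rule integral_eq_zero_AE)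
    then have "(\<integral>p. snd p \<partial>\<mu>) \<le> 0"
      using integral_cond_mean(2)[OF \<nu> gh(2)] mean train by simp
    then have "AE x in ?T. g x = 0" by (rule cond_mean_AE_zero[OF \<mu> gh(1)])
    then have "cond_mean \<mu> (\<lambda>_. 0)"
      by (intro cond_mean_cong_AE[OF \<mu> gh(1)]) auto
    \<comment> \<open>With the zero version for \<open>\<mu>\<close> both products vanish, whatever
      \<open>k\<close> is.\<close>
    moreover have "nondecreasing_ratio_on ?S (\<lambda>_. 0) k"
      by (subst nondecreasing_ratio_on_iff) (auto simp: nonneg)
    ultimately show ?thesis using hk by blast
  qed
  then show ?thesis using train mean unfolding easier_def by auto
qed

theorem propositionB1:
  shows "reflp_on {\<mu>. ljsd \<mu>} easier \<and>
    (\<forall>\<mu> \<nu>. ljsd \<mu> \<longrightarrow> ljsd \<nu> \<longrightarrow> (easier \<mu> \<nu> \<and> easier \<nu> \<mu> \<longleftrightarrow> same_shift \<mu> \<nu>)) \<and>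
    transp_on {\<mu>. ljsd \<mu>} easier"
proof (intro conjI allI impI)
  show "reflp_on {\<mu>. ljsd \<mu>} easier"
    by (rule reflp_onI) (use cond_mean_exists in \<open>auto intro!: same_shift_imp_easier simp: same_shift_def\<close>)
  show "transp_on {\<mu>. ljsd \<mu>} easier"
    by (rule transp_onI) (use easier_trans in blast)
  show "easier \<mu> \<nu> \<and> easier \<nu> \<mu> \<longleftrightarrow> same_shift \<mu> \<nu>" if "ljsd \<mu>" "ljsd \<nu>" for \<mu> \<nu>
    using that easier_antisym same_shift_imp_easier same_shift_sym by blast
qed

end
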